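(* Let $k$ and $n$ be integers with $k\geq 2$ and $n\geq 4$. Let $G$ be an $n$-vertex graph such that there is a labelling $v_1,\ldots,v_n$ of $V(G)$ with the following two properties: (i) for every edge $v_iv_j\in E(G)$ we have $|i-j|\leq k$; (ii) for every $i\in[n]$, \[ \deg_G(v_i)\geq \min\{\,k+2,\ \min\{i-1,k\}+\min\{n-i,k\}\,\}. \] Then $G$ contains a Hamilton cycle.
   Context: For a graph $G$ on $n$ vertices, condition (i) says that the labelling is an embedding of $G$ into $P_n^k$, the $k$-th power of the path $v_1v_2\cdots v_n$ (in which $v_i,v_j$ are adjacent iff $1\le|i-j|\le k$); the number $\min\{i-1,k\}+\min\{n-i,k\}$ is the degree of the $i$-th vertex in $P_n^k$. The paper abbreviates the existence of such a labelling with the condition $\deg_G(v_i)\ge\min\{\ell,\deg_{P_n^k}(v_i)\}$ for all $i$ as $\delta^k_{\mathrm{eff}}(G)\geq \ell$ ("effective minimum degree at least $\ell$"); here $\ell=k+2$. *)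

theory Defs
  imports "Graph_Theory.Pair_Digraph" "Graph_Theory.Arc_Walk"
begin

text \<open>
  A finite simple undirected graph is a \<^locale>\<open>pair_graph\<close>: an edge \<open>uv\<close> is
  represented by the two arcs \<open>(u, v)\<close> and \<open>(v, u)\<close>, so the degree of a vertex is its
  \<^const>\<open>out_degree\<close>.

  In a symmetric digraph \<^const>\<open>pre_digraph.cycle\<close> admits the closed walk \<open>u, v, u\<close>,
  which is not a cycle of the undirected graph; hence the bound on the length.
  Since the walk is closed, the tails of its arcs are exactly the vertices it visits.
\<close>

definition (in pre_digraph) hamilton_cycle :: "'b awalk \<Rightarrow> bool" where
  "hamilton_cycle p \<longleftrightarrow> cycle p \<and> 3 \<le> length p \<and> tail G ` set p = verts G"

end

theory Submission
  imports Defs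
begin

text \<open>
  Identify the vertices with their labels. Starting from the edge \<open>12\<close>, grow a path at both ends:
  always extend the end with the smaller label, and extend it to its smallest unvisited neighbour.
  Orient the edges of the path away from the edge \<open>12\<close>. If \<open>u\<close> is unvisited and \<open>y\<close> is a visited
  neighbour of \<open>u\<close> that is not an end, then the successor of \<open>y\<close> is smaller than \<open>u\<close>, as \<open>y\<close> was not
  extended to \<open>u\<close>. As successors are distinct, counting them bounds the degree of \<open>u\<close>. The same count,
  with at most one exceptional neighbour, bounds the degree of an end that cannot be extended.
  Hence the path gets stuck only when its ends are \<open>n - 1\<close> and \<open>n\<close>, and then it is spanning.
\<close>

section \<open>The labelled graph and the edges forced at its extreme labels\<close>

locale banded_graph =
  fixes n k :: nat and E :: "nat \<Rightarrow> nat \<Rightarrow> bool"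
  assumes k_ge: "2 \<le> k" and n_ge: "4 \<le> n"
    and sym: "E i j \<Longrightarrow> E j i"
    and irrefl: "\<not> E i i"
    and adj_range: "E i j \<Longrightarrow> i \<in> {1..n}"
    and band: "E i j \<Longrightarrow> j \<le> i + k"
    and degree: "i \<in> {1..n} \<Longrightarrow> min (k + 2) (min (i - 1) k + min (n - i) k) \<le> card {j. E i j}"
begin

lemma finite_nbrs: "finite {j. E i j \<and> P j}"
proof (rule finite_subset)
  show "{j. E i j \<and> P j} \<subseteq> {1..n}" using adj_range[OF sym] by blast
qed simp

text \<open>For label 1 the degree bound is \<open>min (n - 1) k\<close>, which is all that the band
  leaves room for; so every possible edge at 1 is present.\<close>

lemma first_adj:
  assumes "j \<in> {2..k + 1}" "j \<le> n"
  shows "E 1 j"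
proof -
  let ?W = "{2..min (k + 1) n}"
  have sub: "{j. E 1 j} \<subseteq> ?W"
  proof
    fix j assume "j \<in> {j. E 1 j}"
    then have e: "E 1 j" by simp
    have "j \<noteq> 1" using e irrefl by metis
    then show "j \<in> ?W" using band[OF e] adj_range[OF sym[OF e]] by auto
  qed
  have "card ?W \<le> card {j. E 1 j}"
    using degree[of 1] n_ge by simp
  then have "{j. E 1 j} = ?W"
    using card_seteq[OF _ sub] by simp
  moreover have "j \<in> ?W" using assms by simp
  ultimately show ?thesis by blast
qed

text \<open>The band leaves no slack at label \<open>n\<close> either. This edge will close the
  spanning path into a cycle.\<close>

lemma last_adj: "E (n - 1) n"
proof -
  let ?W = "{max 1 (n - k)..n - 1}"
  have sub: "{j. E n j} \<subseteq> ?W"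
  proof
    fix j assume "j \<in> {j. E n j}"
    then have e: "E n j" by simp
    have "j \<noteq> n" using e irrefl by metis
    then show "j \<in> ?W" using band[OF sym[OF e]] adj_range[OF sym[OF e]] by auto
  qed
  have "card ?W \<le> card {j. E n j}"
    using degree[of n] n_ge by simp
  then have "{j. E n j} = ?W"
    using card_seteq[OF _ sub] by simp
  moreover have "n - 1 \<in> ?W" using n_ge k_ge by auto
  ultimately show ?thesis using sym by blast
qed

section \<open>The greedy path: invariant, counting bound and extension\<close>

text \<open>
  \<open>R\<close> stands for the edges of the path \<open>p\<close> other than \<open>12\<close>, oriented away from \<open>12\<close>.
  The pair \<open>(y, z)\<close> with \<open>z = w\<close> in the condition on \<open>x\<close> is the exceptional one: it arises
  when the extension of \<open>y\<close> makes \<open>x\<close> the smaller end.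
\<close>

definition greedy :: "nat \<Rightarrow> nat \<Rightarrow> nat list \<Rightarrow> (nat \<times> nat) set \<Rightarrow> bool" where
  "greedy x w p R \<longleftrightarrow>
     p \<noteq> [] \<and> hd p = x \<and> last p = w \<and> x < w \<and> 2 \<le> x \<and> distinct p \<and> successively E p
     \<and> {1, 2} \<subseteq> set p \<and> set p \<subseteq> {1..n}
     \<and> inj_on fst R \<and> inj_on snd R \<and> fst ` R = set p - {x, w} \<and> snd ` R = set p - {1, 2}
     \<and> (\<forall>(y, z)\<in>R. E y z)
     \<and> (\<forall>(y, z)\<in>R. \<forall>u. u \<notin> set p \<longrightarrow> E y u \<longrightarrow> z < u)
     \<and> (\<forall>(y, z)\<in>R. E y x \<longrightarrow> z \<le> x \<or> z = w)
     \<and> (\<forall>(y, z)\<in>R. E y w \<longrightarrow> z \<le> w)"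

text \<open>This is the edge 12 after one extension of its smaller end 1, whose smallest unvisited
  neighbour is 3 because \<open>k \<ge> 2\<close>.\<close>

lemma greedy_init: "\<exists>x w p R. greedy x w p R"
proof -
  have a: "E 1 2" "E 1 3" using first_adj[of 2] first_adj[of 3] k_ge n_ge by auto
  have "3 < u" if "E 1 u" "u \<notin> {1, 2, 3}" for u
    using adj_range[OF sym[OF that(1)]] that(2) by auto
  then have "greedy 2 3 [2, 1, 3] {(1, 3)}"
    unfolding greedy_def using a sym[OF a(1)] n_ge by auto
  then show ?thesis by blast
qed

text \<open>Among the visited labels up to \<open>t\<close> only 1 and 2 are not successors, and
  distinct successors have distinct predecessors. So \<open>card (set p \<inter> {..t}) - 2\<close>
  vertices have a successor up to \<open>t\<close>. These include the neighbours counted here and,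
  disjointly, all visited labels below \<open>t - k\<close>; cancelling the latter leaves the
  window.\<close>

lemma card_succ_le:
  assumes g: "greedy x w p R" and t: "2 \<le> t" "t \<le> x"
  shows "card {y. E t y \<and> (\<exists>z\<le>t. (y, z) \<in> R)} + 2 \<le> card (set p \<inter> {t - k..t})"
proof -
  let ?S = "set p"
  let ?N = "{y. E t y \<and> (\<exists>z\<le>t. (y, z) \<in> R)}"
  let ?C = "{y \<in> ?S. y + k < t}"
  let ?Q = "{r \<in> R. snd r \<le> t}"
  have inj: "inj_on fst R" "inj_on snd R" and
    im: "fst ` R = ?S - {x, w}" "snd ` R = ?S - {1, 2}" and
    adj: "\<And>y z. (y, z) \<in> R \<Longrightarrow> E y z" and xw: "x < w" and s12: "{1, 2} \<subseteq> ?S"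
    using g unfolding greedy_def by auto
  have finR: "finite R" using inj(1) im(1) by (metis finite_Diff finite_set finite_imageD)
  have "snd ` ?Q = snd ` R \<inter> {..t}" by auto
  then have "snd ` ?Q = ?S \<inter> {..t} - {1, 2}" unfolding im(2) by blast
  then have "card (snd ` ?Q) = card (?S \<inter> {..t}) - 2"
    using s12 t by (simp add: card_Diff_subset)
  moreover have "card (snd ` ?Q) = card ?Q"
    by (rule card_image[OF inj_on_subset[OF inj(2)]]) auto
  moreover have "card (fst ` ?Q) = card ?Q"
    by (rule card_image[OF inj_on_subset[OF inj(1)]]) auto
  moreover have "card {1, 2::nat} \<le> card (?S \<inter> {..t})"
    by (rule card_mono) (use s12 t in auto)
  ultimately have cQ: "card (fst ` ?Q) + 2 = card (?S \<inter> {..t})" by simp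
  \<comment> \<open>Such a vertex is not an end, as \<open>t \<le> x < w\<close>, and its successor
    is at most \<open>k\<close> larger, hence below \<open>t\<close>.\<close>
  have "?C \<subseteq> fst ` ?Q"
  proof
    fix y assume y: "y \<in> ?C"
    then have "y \<in> fst ` R" using im(1) t xw by auto
    then obtain z where z: "(y, z) \<in> R" by auto
    then show "y \<in> fst ` ?Q" using band[OF adj[OF z]] y by force
  qed
  moreover have "?N \<subseteq> fst ` ?Q" by force
  moreover have "?N \<inter> ?C = {}" using band[OF sym] by fastforce
  ultimately have "card ?N + card ?C \<le> card (fst ` ?Q)"
    using finR finite_nbrs card_mono[of "fst ` ?Q" "?N \<union> ?C"] card_Un_disjoint[of ?N ?C] by simp
  moreover have "?S \<inter> {..t} = ?C \<union> (?S \<inter> {t - k..t})" by auto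
  then have "card (?S \<inter> {..t}) \<le> card ?C + card (?S \<inter> {t - k..t})"
    by (metis (no_types, lifting) card_Un_le)
  ultimately show ?thesis using cQ by linarith
qed

lemma greedy_extend:
  assumes g: "greedy x w p R" and u: "E x u" "u \<notin> set p"
  shows "\<exists>x' w' z R'. z \<notin> set p \<and> (greedy x' w' (z # p) R' \<or> greedy x' w' (rev (z # p)) R')"
proof -
  let ?S = "set p"
  define z where "z = (LEAST u. E x u \<and> u \<notin> ?S)"
  have z: "E x z" "z \<notin> ?S" unfolding z_def using LeastI[of "\<lambda>u. E x u \<and> u \<notin> ?S" u] u by auto
  have zmin: "z \<le> u" if "E x u" "u \<notin> ?S" for u
    unfolding z_def using that by (intro Least_le) auto
  let ?R = "insert (x, z) R"
  have p: "p \<noteq> []" "hd p = x" "last p = w" "x < w" "2 \<le> x" "distinct p" "successively E p"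
    "1 \<in> ?S" "2 \<in> ?S" "?S \<subseteq> {1..n}" "inj_on fst R" "inj_on snd R" "fst ` R = ?S - {x, w}"
    "snd ` R = ?S - {1, 2}"
    and R: "\<And>y z. (y, z) \<in> R \<Longrightarrow> E y z" "\<And>y z u. (y, z) \<in> R \<Longrightarrow> u \<notin> ?S \<Longrightarrow> E y u \<Longrightarrow> z < u"
    "\<And>y z. (y, z) \<in> R \<Longrightarrow> E y w \<Longrightarrow> z \<le> w"
    using g unfolding greedy_def by auto
  have xw: "x \<in> ?S" "w \<in> ?S" using p(1-3) by auto
  have zn: "z \<in> {1..n}" using adj_range[OF sym[OF z(1)]] .
  have z3: "z \<noteq> 1" "z \<noteq> 2" "z \<noteq> w" "z \<noteq> x" using z(2) p(8,9) xw by auto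
  have inj: "inj_on fst ?R" "inj_on snd ?R"
    using p(11-14) z(2) by (auto simp: inj_on_insert)
  have sim: "snd ` ?R = insert z ?S - {1, 2}"
    using p(14) z3 by auto
  have fim: "fst ` ?R = insert z ?S - {z, w}"
    using p(13) z3 xw p(4) z(2) by auto
  have succ: "successively E (z # p)" using p(1,2,7) sym[OF z(1)] by (simp add: successively_Cons)
  have step: "z' < u" if "(y, z') \<in> ?R" "u \<notin> insert z ?S" "E y u" for y z' u
  proof (cases "(y, z') = (x, z)")
    case True
    then have "z \<le> u" using zmin that by auto
    then show ?thesis using True that by auto
  next
    case False
    then show ?thesis using that R(2) by auto
  qed
  \<comment> \<open>Before the extension \<open>z\<close> was unvisited, so older successors of its
    neighbours are smaller than \<open>z\<close>.\<close>
  have new: "z' \<le> z" if "(y, z') \<in> ?R" "E y z" for y z'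
    using that R(2) z(2) by fastforce
  \<comment> \<open>Only the new pair \<open>(x, z)\<close> can break the condition on
    \<open>w\<close>. It is harmless if \<open>z < w\<close>; otherwise \<open>w\<close> becomes the
    smaller end and \<open>(x, z)\<close> the permitted exception.\<close>
  have old: "z' \<le> w \<or> z' = z" if "(y, z') \<in> ?R" "E y w" for y z'
    using that R(3) by auto
  have greedy: "greedy a b q ?R"
    if "q \<noteq> []" "hd q = a" "last q = b" "a < b" "2 \<le> a" "distinct q" "successively E q"
      and q: "set q = insert z ?S" and ab: "a = z \<and> b = w \<or> a = w \<and> b = z" for a b q
  proof -
    have "{1, 2} \<subseteq> set q" "set q \<subseteq> {1..n}" using q p(8-10) zn by auto
    moreover have "fst ` ?R = set q - {a, b}" using fim q ab by (auto simp only: insert_commute)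
    moreover have "snd ` ?R = set q - {1, 2}" using sim q by simp
    moreover have "\<forall>(y, z')\<in>?R. E y z'" using R(1) z(1) by blast
    moreover have "\<forall>(y, z')\<in>?R. \<forall>u. u \<notin> set q \<longrightarrow> E y u \<longrightarrow> z' < u" using step q by blast
    moreover have "\<forall>(y, z')\<in>?R. E y a \<longrightarrow> z' \<le> a \<or> z' = b" using ab new old by blast
    moreover have "\<forall>(y, z')\<in>?R. E y b \<longrightarrow> z' \<le> b" using ab \<open>a < b\<close> new old by fastforce
    ultimately show ?thesis
      unfolding greedy_def using that(1-7) inj by blast
  qed
  show ?thesis
  proof (cases "z < w")
    case True
    have "2 \<le> z" using zn z3 by auto
    then have "greedy z w (z # p) ?R"
      using p(1,3,6) z(2) succ True by (intro greedy) auto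
    then show ?thesis using z(2) by blast
  next
    case False
    \<comment> \<open>Now \<open>w\<close> is the smaller end, so the path is reversed to put it at
      the head.\<close>
    have "successively E (rev (z # p))"
      unfolding successively_rev by (rule successively_mono[OF succ]) (rule sym)
    then have "greedy w z (rev (z # p)) ?R"
      using False p(1,3-6) z(2) z3 by (intro greedy) (auto simp: hd_append hd_rev)
    then show ?thesis using z(2) by blast
  qed
qed

section \<open>Where the path gets stuck\<close>

text \<open>Every neighbour of \<open>x\<close> is \<open>w\<close>, the predecessor of
  \<open>w\<close>, or a vertex with successor at most \<open>x\<close>. The gain of 2 in
  \<open>card_succ_le\<close> pays for the first two.\<close>

lemma stuck_ends:
  assumes g: "greedy x w p R" and stuck: "\<And>u. E x u \<Longrightarrow> u \<in> set p"
  shows "x = n - 1 \<and> w = n"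
proof -
  let ?S = "set p"
  let ?N = "{y. E x y \<and> (\<exists>z\<le>x. (y, z) \<in> R)}"
  have p: "p \<noteq> []" "last p = w" "x < w" "2 \<le> x" "?S \<subseteq> {1..n}" "inj_on snd R"
    "fst ` R = ?S - {x, w}"
    and exc: "\<And>y z. (y, z) \<in> R \<Longrightarrow> E y x \<Longrightarrow> z \<le> x \<or> z = w"
    using g unfolding greedy_def by auto
  have wn: "w \<le> n" using p(1,2,5) last_in_set[of p] by auto
  let ?X = "fst ` {r \<in> R. snd r = w}"
  have X: "finite ?X" "card ?X \<le> 1"
  proof -
    obtain e where e: "{r \<in> R. snd r = w} \<subseteq> {e}"
    proof (cases "{r \<in> R. snd r = w} = {}")
      case False
      then obtain e where "e \<in> R" "snd e = w" by auto
      then have "r = e" if "r \<in> R" "snd r = w" for r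
        using inj_onD[OF p(6), of r e] that by simp
      then have "{r \<in> R. snd r = w} \<subseteq> {e}" by blast
      then show ?thesis using that by blast
    qed (use that in blast)
    then show "finite ?X" by (meson finite.emptyI finite_imageI finite_insert finite_subset)
    have "?X \<subseteq> {fst e}" using e by auto
    then show "card ?X \<le> 1" using card_mono[of "{fst e}" ?X] by simp
  qed
  have "{y. E x y} \<subseteq> ?N \<union> insert w ?X"
  proof
    fix y assume "y \<in> {y. E x y}"
    then have y: "E x y" by simp
    show "y \<in> ?N \<union> insert w ?X"
    proof (cases "y = w")
      case False
      then have "y \<in> fst ` R" using p(7) stuck[OF y] y irrefl by auto
      then obtain z where "(y, z) \<in> R" by auto
      then show ?thesis using exc[of y z] sym[OF y] y by force
    qed simp
  qed
  then have "card {y. E x y} \<le> card (?N \<union> insert w ?X)"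
    using X finite_nbrs by (intro card_mono) auto
  also have "\<dots> \<le> card ?N + card (insert w ?X)" by (rule card_Un_le)
  also have "card (insert w ?X) \<le> 2" using X by (simp add: card_insert_if)
  finally have "card {y. E x y} \<le> card ?N + 2" by simp
  also have "\<dots> \<le> card (?S \<inter> {x - k..x})" using card_succ_le[OF g p(4)] by simp
  also have "\<dots> \<le> card {max 1 (x - k)..x}" using p(5) by (intro card_mono) auto
  also have "\<dots> = min (x - 1) k + 1" using p(4) by auto
  finally have "min (k + 2) (min (x - 1) k + min (n - x) k) \<le> min (x - 1) k + 1"
    using degree[of x] p(3,4) wn by simp
  \<comment> \<open>The right-hand side is below \<open>k + 2\<close>, so
    \<open>min (n - x) k \<le> 1\<close>, and \<open>k \<ge> 2\<close> rules out \<open>k\<close> as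
    the minimum.\<close>
  then have "n - x < 2" using k_ge by linarith
  then show ?thesis using p(3) wn by auto
qed

text \<open>A neighbour of the largest unvisited label \<open>u\<close> is an end, is unvisited, or
  has a successor below \<open>u\<close>. The gain of 2 in \<open>card_succ_le\<close> pays for the
  two ends, which leaves \<open>u\<close> with too small a degree.\<close>

lemma stuck_spanning:
  assumes g: "greedy (n - 1) n p R"
  shows "set p = {1..n}"
proof (rule ccontr)
  let ?S = "set p"
  have p: "p \<noteq> []" "hd p = n - 1" "last p = n" "{1, 2} \<subseteq> ?S" "?S \<subseteq> {1..n}"
    "fst ` R = ?S - {n - 1, n}"
    and le: "\<And>y z u. (y, z) \<in> R \<Longrightarrow> u \<notin> ?S \<Longrightarrow> E y u \<Longrightarrow> z < u"
    using g unfolding greedy_def by auto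
  assume "?S \<noteq> {1..n}"
  then have ne: "{1..n} - ?S \<noteq> {}" using p(5) by auto
  define u where "u = Max ({1..n} - ?S)"
  have u: "u \<in> {1..n}" "u \<notin> ?S" using Max_in[OF _ ne] unfolding u_def by auto
  have umax: "y \<le> u" if "y \<in> {1..n}" "y \<notin> ?S" for y
    unfolding u_def using that by (intro Max_ge) auto
  have "n - 1 \<in> ?S" "n \<in> ?S" using p(1-3) hd_in_set last_in_set by metis+
  then have "u \<noteq> n - 1" "u \<noteq> n" using u(2) by auto
  then have un: "u + 2 \<le> n" using u(1) by auto
  have "u \<noteq> 1" "u \<noteq> 2" using u(2) p(4) by auto
  then have u2: "2 \<le> u" using u(1) by auto
  let ?N = "{y. E u y \<and> (\<exists>z\<le>u. (y, z) \<in> R)}"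
  let ?D = "{y. E u y \<and> y \<notin> ?S}"
  let ?W = "?S \<inter> {u - k..u}"
  have "{y. E u y} \<subseteq> ?N \<union> {n - 1, n} \<union> ?D"
  proof
    fix y assume "y \<in> {y. E u y}"
    then have y: "E u y" by simp
    show "y \<in> ?N \<union> {n - 1, n} \<union> ?D"
    proof (cases "y \<in> fst ` R")
      case True
      then obtain z where z: "(y, z) \<in> R" by auto
      have "z < u" using le[OF z u(2) sym[OF y]] .
      then show ?thesis using z y by auto
    next
      case False
      then show ?thesis using p(6) y by auto
    qed
  qed
  then have "card {y. E u y} \<le> card (?N \<union> {n - 1, n} \<union> ?D)"
    using finite_nbrs by (intro card_mono) auto
  also have "\<dots> \<le> card ?N + card {n - 1, n} + card ?D"
    using card_Un_le[of "?N \<union> {n - 1, n}" ?D] card_Un_le[of ?N "{n - 1, n}"] by linarith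
  also have "card {n - 1, n} \<le> 2" by (simp add: card_insert_if)
  finally have "card {y. E u y} \<le> card ?N + 2 + card ?D" by simp
  also have "\<dots> \<le> card ?W + card ?D" using card_succ_le[OF g u2] un by simp
  also have "\<dots> = card (?W \<union> ?D)" using finite_nbrs by (intro card_Un_disjoint[symmetric]) auto
  \<comment> \<open>Unvisited neighbours lie below \<open>u\<close> by maximality, and
    \<open>u\<close> itself is not in \<open>?W\<close>.\<close>
  also have "\<dots> \<le> card {max 1 (u - k)..u - 1}"
  proof (rule card_mono)
    show "?W \<union> ?D \<subseteq> {max 1 (u - k)..u - 1}"
    proof
      fix y assume y: "y \<in> ?W \<union> ?D"
      then have "y \<noteq> u" using u(2) irrefl by auto
      moreover have "y \<le> u" "1 \<le> y" "u - k \<le> y"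
        using y umax adj_range[OF sym] p(5) band[OF sym] by fastforce+
      ultimately show "y \<in> {max 1 (u - k)..u - 1}" by auto
    qed
  qed simp
  also have "\<dots> = min (u - 1) k" using u2 by auto
  finally have "min (k + 2) (min (u - 1) k + min (n - u) k) \<le> min (u - 1) k"
    using degree[OF u(1)] by simp
  then show False using un k_ge by linarith
qed

lemma spanning_closed_path:
  "\<exists>p. distinct p \<and> set p = {1..n} \<and> successively E p \<and> E (last p) (hd p)"
proof -
  let ?P = "\<lambda>p. \<exists>x w R. greedy x w p R"
  have bound: "length p \<le> n" if "?P p" for p
  proof -
    have "distinct p" "set p \<subseteq> {1..n}" using that unfolding greedy_def by auto
    then show ?thesis
      using card_mono[of "{1..n}" "set p"] by (simp add: distinct_card)
  qed
  obtain p0 where "?P p0" using greedy_init by blast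
  \<comment> \<open>Choosing a longest path replaces iterating the extension: its smaller end admits
    none.\<close>
  then obtain p where "?P p" and max: "\<And>q. ?P q \<Longrightarrow> length q \<le> length p"
    using ex_has_greatest_nat[of ?P p0 length "n + 1"] bound by (auto simp: less_Suc_eq_le)
  then obtain x w R where g: "greedy x w p R" by blast
  have "u \<in> set p" if "E x u" for u
  proof (rule ccontr)
    assume "u \<notin> set p"
    from greedy_extend[OF g that this] obtain z
      where "?P (z # p) \<or> ?P (rev (z # p))" by blast
    then have "length (z # p) \<le> length p"
      using max[of "z # p"] max[of "rev (z # p)"] unfolding length_rev by blast
    then show False by simp
  qed
  then have "x = n - 1" "w = n" using stuck_ends[OF g] by auto
  then have g': "greedy (n - 1) n p R" using g by simp
  show ?thesis
    using stuck_spanning[OF g'] g' last_adj sym unfolding greedy_def by metis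
qed

end

section \<open>From the closed path to a Hamilton cycle of the digraph\<close>

lemma (in pair_wf_digraph) hamilton_cycle_of_list:
  assumes "distinct q" and "set q = pverts G" and "3 \<le> length q"
    and "successively (\<lambda>a b. (a, b) \<in> parcs G) q" and "(last q, hd q) \<in> parcs G"
  shows "hamilton_cycle (zip q (tl q @ [hd q]))"
proof -
  \<comment> \<open>The endpoint \<open>c\<close> is kept apart from \<open>hd r\<close>, since the
    head changes during the induction while the endpoint stays fixed.\<close>
  have walk: "pcas (hd r) (zip r (tl r @ [c])) c \<and> set (zip r (tl r @ [c])) \<subseteq> parcs G
      \<and> pawalk_verts (hd r) (zip r (tl r @ [c])) = r @ [c]"
    if "r \<noteq> []" "successively (\<lambda>a b. (a, b) \<in> parcs G) r" "(last r, c) \<in> parcs G" for r c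
    using that
  proof (induction r)
    case (Cons a r)
    then show ?case by (cases r) auto
  qed simp
  let ?c = "zip q (tl q @ [hd q])"
  have ne: "q \<noteq> []" using assms(3) by auto
  have len: "length q = length (tl q @ [hd q])" using ne by simp
  note w = walk[OF ne assms(4,5)]
  have "hd q \<in> pverts G" using hd_in_set[OF ne] assms(2) by simp
  then have "awalk (hd q) ?c (hd q)" unfolding awalk_def using w by (intro conjI) blast+
  moreover have "distinct (tl (pawalk_verts (hd q) ?c))"
    using w ne assms(1) by (cases q) auto
  moreover have "?c \<noteq> []" using ne by (cases q) auto
  ultimately have "cycle ?c" unfolding cycle_def by auto
  moreover have "3 \<le> length ?c" using assms(3) by simp
  moreover have "fst ` set ?c = pverts G"
    using len assms(2) by (metis map_fst_zip list.set_map)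
  ultimately show ?thesis unfolding hamilton_cycle_def by simp
qed

theorem theorem2:
  fixes G :: "'a pair_pre_digraph" and n k :: nat
  assumes "k \<ge> 2" and "n \<ge> 4"
    and "pair_graph G" and "card (pverts G) = n"
    and "\<exists>v :: nat \<Rightarrow> 'a. bij_betw v {1..n} (pverts G)
      \<and> (\<forall>i\<in>{1..n}. \<forall>j\<in>{1..n}. (v i, v j) \<in> parcs G \<longrightarrow> \<bar>int i - int j\<bar> \<le> int k)
      \<and> (\<forall>i\<in>{1..n}. out_degree (with_proj G) (v i)
            \<ge> min (k + 2) (min (i - 1) k + min (n - i) k))"
  shows "\<exists>p. pre_digraph.hamilton_cycle (with_proj G) p"
proof -
  interpret pair_graph G by fact
  obtain v where v: "bij_betw v {1..n} (pverts G)"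
    and band: "\<And>i j. i \<in> {1..n} \<Longrightarrow> j \<in> {1..n} \<Longrightarrow> (v i, v j) \<in> parcs G \<Longrightarrow> \<bar>int i - int j\<bar> \<le> int k"
    and deg: "\<And>i. i \<in> {1..n} \<Longrightarrow>
      min (k + 2) (min (i - 1) k + min (n - i) k) \<le> out_degree (with_proj G) (v i)"
    using assms(5) by blast
  have inj: "inj_on v {1..n}" and img: "v ` {1..n} = pverts G"
    using v by (auto simp: bij_betw_def)
  \<comment> \<open>Adjacency is pulled back to labels; the range is built in because
    \<open>v\<close> is controlled only on \<open>{1..n}\<close>.\<close>
  define E where "E i j \<longleftrightarrow> i \<in> {1..n} \<and> j \<in> {1..n} \<and> (v i, v j) \<in> parcs G" for i j
  have outdeg: "out_degree (with_proj G) (v i) = card {j. E i j}" if "i \<in> {1..n}" for i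
  proof -
    have "out_arcs (with_proj G) (v i) = (\<lambda>j. (v i, v j)) ` {j. E i j}"
    proof (intro equalityI subsetI)
      fix e assume "e \<in> out_arcs (with_proj G) (v i)"
      then have e: "e \<in> parcs G" "fst e = v i" by auto
      then have "snd e \<in> v ` {1..n}" using arc_snd_in_verts img by auto
      then obtain j where j: "j \<in> {1..n}" "snd e = v j" by auto
      then have "e = (v i, v j)" using e(2) by (simp add: prod_eq_iff)
      then show "e \<in> (\<lambda>j. (v i, v j)) ` {j. E i j}"
        using e(1) j(1) that unfolding E_def by blast
    qed (auto simp: E_def)
    moreover have "inj_on (\<lambda>j. (v i, v j)) {j. E i j}"
      by (rule inj_onI) (use inj_onD[OF inj] in \<open>simp add: E_def\<close>)
    ultimately show ?thesis by (simp add: out_degree_def card_image)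
  qed
  interpret B: banded_graph n k E
  proof
    show "E j i" if "E i j" for i j
      using that arcs_symmetric unfolding E_def by auto
    show "\<not> E i i" for i using no_loops' unfolding E_def by blast
    show "j \<le> i + k" if "E i j" for i j
      using band[of i j] that unfolding E_def by auto
  qed (use assms(1,2) deg outdeg in \<open>auto simp: E_def\<close>)
  obtain p where p: "distinct p" "set p = {1..n}" "successively E p" "E (last p) (hd p)"
    using B.spanning_closed_path by blast
  have len: "length p = n" using p(1,2) distinct_card[of p] by simp
  then have ne: "p \<noteq> []" using assms(2) by auto
  have "hamilton_cycle (zip (map v p) (tl (map v p) @ [hd (map v p)]))"
  proof (rule hamilton_cycle_of_list)
    show "distinct (map v p)" using p(1,2) inj by (simp add: distinct_map)
    show "set (map v p) = pverts G" using p(2) img by simp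
    show "3 \<le> length (map v p)" using len assms(2) by simp
    show "successively (\<lambda>a b. (a, b) \<in> parcs G) (map v p)"
      unfolding successively_map using p(3) by (rule successively_mono) (simp add: E_def)
    show "(last (map v p), hd (map v p)) \<in> parcs G"
      using p(4) ne by (simp add: E_def last_map hd_map)
  qed
  then show ?thesis by blast
qed

end
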